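(* Consider the source model in which all source symbols have the same length $L$, in the asymptotic regime described in the context. For any $\gamma\in(\delta,\tfrac12)$, the performance of adaptive fixed-length deduplication (AFLD) with first-stage parsing length $D=L$ and chunk length $\ell=\left\lceil \frac{\log(B/A)}{H(\gamma,\delta)}\right\rceil$ satisfies, as $B\to\infty$, $$1\le \frac{\mathbb{E}[\mathcal{L}_{AF}(\boldsymbol{s})]}{H(\boldsymbol{s})}\le \frac{1+k_1}{k_2}\cdot\frac{H(\gamma,\delta)}{H(\delta)}\cdot(1+o(1)).$$
   Context: All logarithms are base 2. $H(p)=p\log\frac1p+(1-p)\log\frac1{1-p}$ is the binary entropy and $H(p,q)=p\log\frac1q+(1-p)\log\frac1{1-q}$ the binary cross entropy. Source model (equal symbol lengths). Parameters: positive integers $A,B,L$ and an edit probability $\delta$. Source symbols $X_1,\dots,X_A$ are drawn independently and uniformly from $\{0,1\}^L$ (with replacement). Then, independently for $b=1,\dots,B$, an index $J_b$ is drawn uniformly from $\{1,\dots,A\}$ and the source block $Y_b$ is obtained from $X_{J_b}$ by a $\delta$-edit, i.e. by flipping each bit independently with probability $\delta$. The data stream is $\boldsymbol{s}=Y_1Y_2\cdots Y_B$; $H(\boldsymbol{s})$ is its Shannon entropy in bits. Asymptotic regime. $B\to\infty$; $A$ and $L$ are functions of $B$ tending to infinity with $A\le B^{1-k_2}$ for a fixed $0<k_2<1$ and $L=\Theta(B^{k_1})$ for a fixed $k_1>0$; $\delta\in(0,\frac12)$ is constant. Dictionary encoding of a parsed string. Given a parsing of $\boldsymbol{s}$ into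 consecutive chunks, the encoding starts with a prefix-free (Elias gamma) encoding of $|\boldsymbol{s}|$ (at most $2\log|\boldsymbol{s}|+3$ bits). Chunks are then processed in order, starting with an empty dictionary. A chunk different from all previous chunks is encoded as the bit 1 followed by the chunk itself, and is entered into the dictionary. A chunk equal to an earlier one is encoded as the bit 0 followed by a pointer (index) to its dictionary entry; if the current dictionary has size $t$, the pointer takes $\lceil\log t\rceil$ bits (so at most $\log t+1$). Modified fixed-length deduplication (mFLD) with first-stage parsing length $D$ and chunk length $\ell\le D$: $\boldsymbol{s}$ is parsed into consecutive segments of length $D$ (the last one possibly shorter), and each segment is parsed into consecutive chunks of length $\ell$ (the last chunk of a segment possibly shorter). The dictionary encoding is applied to the resulting chunks. AFLD with parameters $D$ and $\gamma\in(\delta,1/2)$ is mFLD with first-stage parsing length $D$ and chunk length $\ell=\left\lceil\frac{\log(B/A)}{H(\gamma,\delta)}\right\rceil$ (and $\ell=D$ if $D$ is smaller than this value). $\mathcal{L}_{AF}(\boldsymbol{s})$ is the number of bits AFLD uses to encode $\boldsymbol{s}$. *)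

theory Defs
  imports "HOL-Probability.Probability" "HOL-Library.Landau_Symbols"
begin

definition bin_entropy :: "real \<Rightarrow> real" where
  "bin_entropy p = p * log 2 (1 / p) + (1 - p) * log 2 (1 / (1 - p))"

definition cross_entropy :: "real \<Rightarrow> real \<Rightarrow> real" where
  "cross_entropy p q = p * log 2 (1 / q) + (1 - p) * log 2 (1 / (1 - q))"

text \<open>
  The library entropy is the negated divergence from the counting measure to the law of the
  random variable; \<open>pmf_entropy_eq_sum\<close> below gives the familiar formula.
\<close>

definition pmf_entropy :: "'a::countable pmf \<Rightarrow> real" where
  "pmf_entropy p = prob_space.entropy (measure_pmf p) 2 (count_space UNIV) (\<lambda>x. x)"

lemma pmf_entropy_eq_sum:
  fixes p :: "'a::countable pmf"
  assumes fin: "finite (set_pmf p)"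
  shows "pmf_entropy p = (\<Sum>x\<in>set_pmf p. pmf p x * log 2 (1 / pmf p x))"
proof -
  interpret information_space "measure_pmf p" 2
    by unfold_locales auto
  interpret S: sigma_finite_measure "count_space (UNIV :: 'a set)"
    by (intro sigma_finite_measure_count_space_countable) auto
  have d: "distributed (measure_pmf p) (count_space UNIV) (\<lambda>x. x) (\<lambda>x. ennreal (pmf p x))"
    unfolding distributed_def
    by (auto simp: measure_pmf_eq_density[symmetric] distr_cong[of _ _ "count_space UNIV" "measure_pmf p"])
  have "pmf_entropy p = - (\<integral>x. pmf p x * log 2 (pmf p x) \<partial>count_space UNIV)"
    unfolding pmf_entropy_def by (rule entropy_distr[OF d]) auto
  also have "(\<integral>x. pmf p x * log 2 (pmf p x) \<partial>count_space UNIV)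
      = (\<Sum>x\<in>set_pmf p. pmf p x * log 2 (pmf p x))"
    by (subst lebesgue_integral_count_space_finite_support)
       (auto intro!: sum.mono_neutral_left finite_subset[OF _ fin] simp: set_pmf_eq)
  finally show ?thesis
    by (auto simp: sum_negf[symmetric] log_divide set_pmf_eq intro!: sum.cong)
qed

text \<open>Bits are booleans; adding a noise bit modulo 2 is inequality.\<close>

definition edit_pmf :: "real \<Rightarrow> bool list \<Rightarrow> bool list pmf" where
  "edit_pmf \<delta> x = map_pmf (map2 (\<noteq>) x) (replicate_pmf (length x) (bernoulli_pmf \<delta>))"

text \<open>Symbol indices run from \<open>0\<close> to \<open>A - 1\<close>. The source is meaningful only for \<open>A > 0\<close>.\<close>

definition source_pmf :: "nat \<Rightarrow> nat \<Rightarrow> nat \<Rightarrow> real \<Rightarrow> bool list pmf" where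
  "source_pmf A B L \<delta> = do {
     X \<leftarrow> replicate_pmf A (pmf_of_set {x. length x = L});
     Y \<leftarrow> replicate_pmf B (do { J \<leftarrow> pmf_of_set {..<A}; edit_pmf \<delta> (X ! J) });
     return_pmf (concat Y)
   }"

definition to_bits :: "nat \<Rightarrow> nat \<Rightarrow> bool list" where
  "to_bits w n = map (bit n) (rev [0..<w])"

text \<open>Only used for \<open>n > 0\<close>, where it is prefix-free.\<close>

definition elias_gamma :: "nat \<Rightarrow> bool list" where
  "elias_gamma n =
     (let k = nat \<lfloor>log 2 (real n)\<rfloor> in replicate k False @ to_bits (Suc k) n)"

text \<open>
  A dictionary is the list of its entries in order of insertion. A pointer is the 0-based
  position of an entry, written with a fixed width depending only on the dictionary size.
\<close>

definition pointer :: "bool list list \<Rightarrow> bool list \<Rightarrow> bool list" where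
  "pointer dict c = to_bits (nat \<lceil>log 2 (real (length dict))\<rceil>)
                            (LEAST i. i < length dict \<and> dict ! i = c)"

primrec encode_chunks :: "bool list list \<Rightarrow> bool list list \<Rightarrow> bool list" where
  "encode_chunks dict [] = []"
| "encode_chunks dict (c # cs) =
     (if c \<in> set dict then False # pointer dict c @ encode_chunks dict cs
      else True # c @ encode_chunks (dict @ [c]) cs)"

definition dict_encode :: "bool list list \<Rightarrow> bool list" where
  "dict_encode cs = elias_gamma (length (concat cs)) @ encode_chunks [] cs"

text \<open>The value at chunk length \<open>0\<close> is a dummy.\<close>

function chunks :: "nat \<Rightarrow> 'a list \<Rightarrow> 'a list list" where
  "chunks n xs = (if n = 0 \<or> xs = [] then [] else take n xs # chunks n (drop n xs))"
  by pat_completeness auto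
termination by (relation "Wellfounded.measure (length \<circ> snd)") auto

declare chunks.simps [simp del]

lemma concat_chunks: "n > 0 \<Longrightarrow> concat (chunks n xs) = xs"
  by (induction n xs rule: chunks.induct) (subst chunks.simps, auto)

definition mfld_chunks :: "nat \<Rightarrow> nat \<Rightarrow> 'a list \<Rightarrow> 'a list list" where
  "mfld_chunks D l s = concat (map (chunks l) (chunks D s))"

lemma concat_mfld_chunks: "D > 0 \<Longrightarrow> l > 0 \<Longrightarrow> concat (mfld_chunks D l s) = s"
proof -
  assume "D > 0" "l > 0"
  have "concat (concat (map (chunks l) xss)) = concat xss" for xss :: "'a list list"
    by (induction xss) (simp_all add: concat_chunks \<open>l > 0\<close>)
  then show ?thesis
    by (simp add: mfld_chunks_def concat_chunks \<open>D > 0\<close>)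
qed

definition mfld_encode :: "nat \<Rightarrow> nat \<Rightarrow> bool list \<Rightarrow> bool list" where
  "mfld_encode D l s = dict_encode (mfld_chunks D l s)"

definition afld_chunk_length :: "nat \<Rightarrow> nat \<Rightarrow> nat \<Rightarrow> real \<Rightarrow> real \<Rightarrow> nat" where
  "afld_chunk_length A B D \<delta> \<gamma> =
     min D (nat \<lceil>log 2 (real B / real A) / cross_entropy \<gamma> \<delta>\<rceil>)"

definition afld_length :: "nat \<Rightarrow> nat \<Rightarrow> nat \<Rightarrow> real \<Rightarrow> real \<Rightarrow> bool list \<Rightarrow> nat" where
  "afld_length A B D \<delta> \<gamma> s = length (mfld_encode D (afld_chunk_length A B D \<delta> \<gamma>) s)"

end

theory Submission
  imports Defs "HOL-Real_Asymp.Real_Asymp"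
begin

text \<open>
  Moving all the noise to the end, \<open>s\<close> is the \<open>\<delta>\<close>-edit of a clean word of length \<open>B L\<close>, so by
  concavity of entropy \<open>H(s) \<ge> B L H(\<delta>)\<close>. The length of \<open>s\<close> fixes the lengths of all its chunks, and
  for fixed chunk lengths the dictionary encoding satisfies Kraft's inequality; with Gibbs'
  inequality this gives \<open>H(s) \<le> E[L_AF(s)]\<close>.

  For the upper bound, the pointers of the roughly \<open>B L / l\<close> chunks cost \<open>log (B L) \<approx> (1 + k1) log B\<close>
  bits each, and \<open>l \<ge> k2 log B / H(\<gamma>, \<delta>)\<close>; this is the main term. The new chunks are negligible: pick
  \<open>\<delta> < \<gamma>' < \<gamma>\<close>. By a Chernoff bound only a vanishing fraction of the chunks has more than \<open>\<gamma>' l\<close>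
  flipped bits. A noise word with at most \<open>\<gamma>' l\<close> ones has probability at least \<open>2 powr (- l H(\<gamma>', \<delta>))\<close>,
  so each of the at most \<open>A (L / l + 1)\<close> clean chunks has at most \<open>2 powr (l H(\<gamma>', \<delta>))\<close> near copies. As
  \<open>H(\<gamma>', \<delta>) < H(\<gamma>, \<delta>)\<close>, this is a factor \<open>(B / A) powr (H(\<gamma>', \<delta>) / H(\<gamma>, \<delta>)) = o(B / A)\<close>.
\<close>

section \<open>Chunks and the dictionary encoding\<close>

lemma chunks_Nil [simp]: "chunks n [] = []"
  by (subst chunks.simps) simp

lemma chunks_nonempty:
  "n > 0 \<Longrightarrow> xs \<noteq> [] \<Longrightarrow> chunks n xs = take n xs # chunks n (drop n xs)"
  by (subst chunks.simps) simp

lemma chunks_0 [simp]: "chunks 0 xs = []"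
  by (subst chunks.simps) simp

lemma chunks_map: "chunks n (map f xs) = map (map f) (chunks n xs)"
proof (induction n xs rule: chunks.induct)
  case (1 n xs)
  show ?case
  proof (cases "n = 0 \<or> xs = []")
    case False
    then show ?thesis using 1 by (simp add: chunks_nonempty take_map drop_map)
  qed auto
qed

text \<open>Parsing never looks at the symbols. Applied to the projections of a zipped pair of
  words, this keeps the chunks of the clean word, of the noise and of their sum aligned.\<close>

lemma mfld_chunks_map: "mfld_chunks D l (map f s) = map (map f) (mfld_chunks D l s)"
  by (simp add: mfld_chunks_def chunks_map map_concat comp_def)

text \<open>Relabelling every symbol as \<open>()\<close> leaves the chunk lengths unchanged, so
  they depend on \<open>length s\<close> alone. This fixes the shape in Kraft's inequality.\<close>

lemma map_length_mfld_chunks: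
  "map length (mfld_chunks D l s) = map length (mfld_chunks D l (replicate (length s) ()))"
proof -
  have "map length (mfld_chunks D l s) = map length (mfld_chunks D l (map (\<lambda>_. ()) s))"
    by (simp add: mfld_chunks_map comp_def)
  also have "map (\<lambda>_. ()) s = replicate (length s) ()"
    by (rule map_replicate_const)
  finally show ?thesis .
qed

lemma mfld_chunks_append:
  assumes "length xs = D" "D > 0"
  shows "mfld_chunks D l (xs @ ys) = chunks l xs @ mfld_chunks D l ys"
proof -
  have "chunks D (xs @ ys) = xs # chunks D ys"
    using assms by (subst chunks_nonempty) auto
  then show ?thesis by (simp add: mfld_chunks_def)
qed

lemma mfld_chunks_Nil [simp]: "mfld_chunks D l [] = []"
  by (simp add: mfld_chunks_def)

lemma mfld_chunks_concat:
  assumes "\<forall>w\<in>set ws. length w = D" "D > 0"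
  shows "mfld_chunks D l (concat ws) = concat (map (chunks l) ws)"
  using assms(1) by (induction ws) (simp_all add: mfld_chunks_append assms(2))

lemma length_chunks_le:
  assumes "l > 0"
  shows "real (length (chunks l xs)) \<le> real (length xs) / real l + 1"
  using assms
proof (induction l xs rule: chunks.induct)
  case (1 l xs)
  show ?case
  proof (cases "xs = []")
    case True
    then show ?thesis by simp
  next
    case False
    have eq: "chunks l xs = take l xs # chunks l (drop l xs)"
      using 1 False by (simp add: chunks_nonempty)
    show ?thesis
    proof (cases "length xs \<le> l")
      case True
      then show ?thesis using eq by simp
    next
      case False
      then have "real (length (chunks l (drop l xs))) \<le> (real (length xs) - real l) / real l + 1"
        using 1 \<open>xs \<noteq> []\<close> by (simp add: of_nat_diff)
      then show ?thesis using eq \<open>l > 0\<close> by (simp add: field_simps)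
    qed
  qed
qed

lemma length_in_chunks_le: "x \<in> set (chunks l xs) \<Longrightarrow> length x \<le> l"
proof (induction l xs rule: chunks.induct)
  case (1 l xs)
  show ?case
  proof (cases "l = 0 \<or> xs = []")
    case True
    then show ?thesis using "1.prems" by auto
  next
    case False
    then show ?thesis using 1 by (auto simp: chunks_nonempty)
  qed
qed

lemma length_in_mfld_chunks_le: "x \<in> set (mfld_chunks D l s) \<Longrightarrow> length x \<le> l"
  by (auto simp: mfld_chunks_def length_in_chunks_le)

section \<open>Length of the encoding\<close>

lemma length_to_bits [simp]: "length (to_bits w n) = w"
  by (simp add: to_bits_def)

lemma length_elias_gamma_le:
  assumes "n > 0"
  shows "real (length (elias_gamma n)) \<le> 2 * log 2 (real n) + 1"
proof -
  have "log 2 (real n) \<ge> 0" using assms by simp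
  then have "real (nat \<lfloor>log 2 (real n)\<rfloor>) \<le> log 2 (real n)" by linarith
  then show ?thesis by (simp add: elias_gamma_def Let_def)
qed

text \<open>Dictionary size plus number of remaining chunks never grows, so \<open>N\<close> bounds
  every dictionary met on the way. Each chunk, new or not, is charged a flag, a rounding bit and
  \<open>log 2 N\<close> pointer bits; each distinct new chunk is charged \<open>l\<close>
  more.\<close>

lemma length_encode_chunks_le:
  assumes "real (length d + length cs) \<le> N" "1 \<le> N" "\<forall>c\<in>set cs. length c \<le> l"
  shows "real (length (encode_chunks d cs))
    \<le> real (length cs) * (2 + log 2 N) + real l * real (card (set cs - set d))"
  using assms
proof (induction cs arbitrary: d)
  case Nil
  then show ?case by simp
next
  case (Cons c cs)
  have logN: "0 \<le> log 2 N" using Cons.prems by simp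
  show ?case
  proof (cases "c \<in> set d")
    case True
    then have d: "length d > 0" by auto
    then have "real (nat \<lceil>log 2 (real (length d))\<rceil>) \<le> log 2 (real (length d)) + 1"
      using zero_le_log_cancel_iff[of 2 "real (length d)"] by linarith
    also have "\<dots> \<le> log 2 N + 1" using d Cons.prems by simp
    finally have "real (length (pointer d c)) \<le> log 2 N + 1" by (simp add: pointer_def)
    moreover have "real (length (encode_chunks d cs))
        \<le> real (length cs) * (2 + log 2 N) + real l * real (card (set cs - set d))"
      using Cons.prems by (intro Cons.IH) auto
    ultimately show ?thesis using True by (simp add: insert_Diff_if algebra_simps)
  next
    case False
    have "set (c # cs) - set d = insert c (set cs - set (d @ [c]))" using False by auto
    then have "card (set (c # cs) - set d) = Suc (card (set cs - set (d @ [c])))" by simp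
    moreover have "real (length (encode_chunks (d @ [c]) cs))
        \<le> real (length cs) * (2 + log 2 N) + real l * real (card (set cs - set (d @ [c])))"
      using Cons.prems by (intro Cons.IH) auto
    moreover have "real (length c) \<le> real l" using Cons.prems by simp
    ultimately show ?thesis using False logN by (simp add: algebra_simps)
  qed
qed

section \<open>Kraft's inequality\<close>

lemma finite_lists_shape: "finite {cs :: bool list list. map length cs = ns}"
proof (rule finite_subset)
  show "{cs :: bool list list. map length cs = ns}
      \<subseteq> {cs. set cs \<subseteq> {c. set c \<subseteq> UNIV \<and> length c \<le> sum_list ns} \<and> length cs = length ns}"
    by (auto simp: member_le_sum_list)
  show "finite {cs. set cs \<subseteq> {c :: bool list. set c \<subseteq> UNIV \<and> length c \<le> sum_list ns}
      \<and> length cs = length ns}"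
    by (intro finite_lists_length_eq finite_lists_length_le) simp
qed

lemma finite_bool_lists [simp]: "finite {c :: bool list. length c = n}"
  using finite_lists_length_eq[of "UNIV :: bool set" n] by simp

text \<open>With the chunk lengths known, a decoder can tell where each raw chunk ends, so the code
  is prefix-free. The induction splits off the first chunk: pointers and raw chunks each contribute
  at most one half.\<close>

lemma encode_chunks_kraft:
  "(\<Sum>cs | map length cs = ns. (1/2 :: real) ^ length (encode_chunks d cs)) \<le> 1"
proof (induction ns arbitrary: d)
  case Nil
  then show ?case by simp
next
  case (Cons n ns)
  let ?S = "{cs :: bool list list. map length cs = ns}"
  let ?C = "{c :: bool list. length c = n}"
  let ?f = "\<lambda>d cs. (1/2 :: real) ^ length (encode_chunks d cs)"
  let ?w = "nat \<lceil>log 2 (real (length d))\<rceil>"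
  have "{cs :: bool list list. map length cs = n # ns} = (\<lambda>(c, cs). c # cs) ` (?C \<times> ?S)"
    by (auto simp: map_eq_Cons_conv)
  then have "(\<Sum>cs | map length cs = n # ns. ?f d cs) = (\<Sum>(c, cs)\<in>?C \<times> ?S. ?f d (c # cs))"
    by (simp add: sum.reindex inj_on_def case_prod_beta)
  also have "\<dots> = (\<Sum>c\<in>?C. \<Sum>cs\<in>?S. ?f d (c # cs))"
    by (simp add: sum.cartesian_product)
  \<comment> \<open>A dictionary chunk gets both weights here; this is harmless, as the raw weights
    summed over all of \<open>?C\<close> are still at most 1/2.\<close>
  also have "\<dots> \<le> (\<Sum>c\<in>?C. (if c \<in> set d then (1/2) ^ Suc ?w else 0) + (1/2) ^ Suc n)"
  proof (intro sum_mono)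
    fix c :: "bool list" assume c: "c \<in> ?C"
    show "(\<Sum>cs\<in>?S. ?f d (c # cs)) \<le> (if c \<in> set d then (1/2) ^ Suc ?w else 0) + (1/2) ^ Suc n"
    proof (cases "c \<in> set d")
      case True
      then have "(\<Sum>cs\<in>?S. ?f d (c # cs)) = (1/2) ^ Suc ?w * (\<Sum>cs\<in>?S. ?f d cs)"
        by (simp add: pointer_def power_add sum_distrib_left mult.assoc)
      also have "\<dots> \<le> (1/2) ^ Suc ?w * 1"
        by (intro mult_left_mono Cons.IH) simp
      finally show ?thesis using True by (simp add: add_increasing2)
    next
      case False
      then have "(\<Sum>cs\<in>?S. ?f d (c # cs)) = (1/2) ^ Suc n * (\<Sum>cs\<in>?S. ?f (d @ [c]) cs)"
        using c by (simp add: power_add sum_distrib_left mult.assoc)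
      also have "\<dots> \<le> (1/2) ^ Suc n * 1"
        by (intro mult_left_mono Cons.IH) simp
      finally show ?thesis using False by simp
    qed
  qed
  also have "\<dots> = real (card (?C \<inter> set d)) * (1/2) ^ Suc ?w + real (card ?C) * (1/2) ^ Suc n"
    by (simp add: sum.distrib sum.inter_restrict[symmetric])
  also have "\<dots> \<le> 1/2 + 1/2"
  proof (intro add_mono)
    have "card ?C = 2 ^ n"
      using card_lists_length_eq[of "UNIV :: bool set" n] by simp
    then show "real (card ?C) * (1/2) ^ Suc n \<le> 1/2"
      by (simp add: power_divide)
    have "real (card (?C \<inter> set d)) \<le> real (length d)"
      using card_mono[of "set d" "?C \<inter> set d"] card_length[of d] by simp
    also have "real (length d) \<le> 2 ^ ?w"
    \<comment> \<open>\<open>log 2 0\<close> is only a default value, so the empty dictionary, where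
      the left side is 0, is treated apart.\<close>
    proof (cases "d = []")
      case False
      then have "real (length d) = 2 powr (log 2 (real (length d)))" by simp
      also have "\<dots> \<le> 2 powr real ?w"
        by (intro powr_mono real_nat_ceiling_ge) simp
      also have "\<dots> = 2 ^ ?w" by (simp add: powr_realpow)
      finally show ?thesis .
    qed simp
    finally show "real (card (?C \<inter> set d)) * (1/2) ^ Suc ?w \<le> 1/2"
      by (simp add: power_divide field_simps)
  qed
  finally show ?case by simp
qed

text \<open>Dropping the length header only increases the sum. Since \<open>concat\<close> inverts
  the parsing, distinct words yield distinct chunk lists, all of one shape, and
  \<open>encode_chunks_kraft\<close> applies.\<close>

lemma mfld_encode_kraft:
  assumes "D > 0" "l > 0"
  shows "(\<Sum>s | length s = n. (1/2 :: real) ^ length (mfld_encode D l s)) \<le> 1"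
proof -
  let ?ns = "map length (mfld_chunks D l (replicate n ()))"
  let ?f = "\<lambda>cs. (1/2 :: real) ^ length (encode_chunks [] cs)"
  have inj: "inj_on (mfld_chunks D l) {s :: bool list. length s = n}"
    by (rule inj_on_inverseI[of _ concat]) (simp add: concat_mfld_chunks assms)
  have "(\<Sum>s | length s = n. (1/2 :: real) ^ length (mfld_encode D l s))
      \<le> (\<Sum>s | length s = n. ?f (mfld_chunks D l s))"
    by (intro sum_mono power_decreasing) (auto simp: mfld_encode_def dict_encode_def)
  also have "\<dots> = (\<Sum>cs\<in>mfld_chunks D l ` {s. length s = n}. ?f cs)"
    by (simp add: sum.reindex[OF inj])
  also have "\<dots> \<le> (\<Sum>cs | map length cs = ?ns. ?f cs)"
    by (intro sum_mono2 finite_lists_shape) (auto intro: map_length_mfld_chunks)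
  also have "\<dots> \<le> 1" by (rule encode_chunks_kraft)
  finally show ?thesis .
qed

lemma length_mfld_encode_le:
  assumes "length s = n" "n > 0" "D > 0" "l > 0" "real (length (mfld_chunks D l s)) \<le> N" "1 \<le> N"
  shows "real (length (mfld_encode D l s)) \<le> 2 * log 2 n + 1 + N * (2 + log 2 N)
    + real l * real (card (set (mfld_chunks D l s)))"
proof -
  let ?cs = "mfld_chunks D l s"
  have "real (length (encode_chunks [] ?cs))
      \<le> real (length ?cs) * (2 + log 2 N) + real l * real (card (set ?cs - set []))"
    using assms by (intro length_encode_chunks_le) (auto simp: length_in_mfld_chunks_le)
  moreover have "real (length ?cs) * (2 + log 2 N) \<le> N * (2 + log 2 N)"
    using assms by (intro mult_right_mono) auto
  moreover have "real (length (elias_gamma n)) \<le> 2 * log 2 n + 1"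
    by (rule length_elias_gamma_le) fact
  ultimately show ?thesis
    using assms by (simp add: mfld_encode_def dict_encode_def concat_mfld_chunks)
qed

section \<open>Noise words\<close>

lemma expectation_cong_pmf:
  assumes "\<And>x. x \<in> set_pmf p \<Longrightarrow> f x = g x"
  shows "measure_pmf.expectation p f = measure_pmf.expectation p g"
  by (intro integral_cong_AE) (simp_all add: AE_measure_pmf_iff assms)

lemma expectation_mono_pmf:
  fixes f g :: "'a \<Rightarrow> real"
  assumes "finite (set_pmf p)" "\<And>x. x \<in> set_pmf p \<Longrightarrow> f x \<le> g x"
  shows "measure_pmf.expectation p f \<le> measure_pmf.expectation p g"
  by (intro integral_mono_AE integrable_measure_pmf_finite)
     (simp_all add: AE_measure_pmf_iff assms)

lemma expectation_le_const_pmf: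
  fixes f :: "'a \<Rightarrow> real"
  assumes "finite (set_pmf p)" "\<And>x. x \<in> set_pmf p \<Longrightarrow> f x \<le> c"
  shows "measure_pmf.expectation p f \<le> c"
  using expectation_mono_pmf[of p f "\<lambda>_. c"] assms by simp

lemma expectation_ge_const_pmf:
  fixes f :: "'a \<Rightarrow> real"
  assumes "finite (set_pmf p)" "\<And>x. x \<in> set_pmf p \<Longrightarrow> c \<le> f x"
  shows "c \<le> measure_pmf.expectation p f"
  using expectation_mono_pmf[of p "\<lambda>_. c" f] assms by simp

lemma expectation_add_pmf:
  fixes f g :: "'a \<Rightarrow> real"
  assumes "finite (set_pmf p)"
  shows "measure_pmf.expectation p (\<lambda>x. f x + g x)
    = measure_pmf.expectation p f + measure_pmf.expectation p g"
  by (intro Bochner_Integration.integral_add integrable_measure_pmf_finite assms)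

lemma expectation_bind_pmf:
  fixes h :: "'b \<Rightarrow> real"
  assumes "finite (set_pmf p)" "\<And>x. x \<in> set_pmf p \<Longrightarrow> finite (set_pmf (f x))"
  shows "measure_pmf.expectation (p \<bind> f) h
    = measure_pmf.expectation p (\<lambda>x. measure_pmf.expectation (f x) h)"
  using assms
  by (subst pmf_expectation_bind[of "set_pmf p"]) (auto simp: integral_measure_pmf[of "set_pmf p"])

section \<open>Words of independent symbols\<close>

lemma finite_set_replicate_pmf [simp]:
  "finite (set_pmf p) \<Longrightarrow> finite (set_pmf (replicate_pmf n p))"
  by (auto simp: set_replicate_pmf lists_eq_set intro: finite_lists_length_eq)

lemma expectation_replicate_pmf_Suc:
  fixes h :: "'a list \<Rightarrow> real"
  assumes "finite (set_pmf p)"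
  shows "measure_pmf.expectation (replicate_pmf (Suc n) p) h
    = measure_pmf.expectation p (\<lambda>x. measure_pmf.expectation (replicate_pmf n p) (\<lambda>xs. h (x # xs)))"
  using assms by (simp add: expectation_bind_pmf)

lemma expectation_replicate_pmf_append:
  fixes f g h :: "'a list \<Rightarrow> real"
  assumes "finite (set_pmf p)"
    and "\<And>xs ys. length xs = m \<Longrightarrow> length ys = n \<Longrightarrow> h (xs @ ys) = f xs + g ys"
  shows "measure_pmf.expectation (replicate_pmf (m + n) p) h
    = measure_pmf.expectation (replicate_pmf m p) f + measure_pmf.expectation (replicate_pmf n p) g"
proof -
  have "measure_pmf.expectation (replicate_pmf (m + n) p) h
      = measure_pmf.expectation (replicate_pmf m p)
          (\<lambda>xs. measure_pmf.expectation (replicate_pmf n p) (\<lambda>ys. h (xs @ ys)))"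
    using assms(1) by (simp add: replicate_pmf_distrib expectation_bind_pmf)
  also have "\<dots> = measure_pmf.expectation (replicate_pmf m p)
          (\<lambda>xs. measure_pmf.expectation (replicate_pmf n p) (\<lambda>ys. f xs + g ys))"
    by (intro expectation_cong_pmf) (auto simp: set_replicate_pmf assms(2))
  finally show ?thesis using assms(1) by (simp add: expectation_add_pmf)
qed

text \<open>Linearity of expectation: there are at most \<open>n / l + 1\<close> chunks, each a word
  of independent symbols. The hypothesis covers all \<open>k \<le> l\<close> because the last chunk
  may be short.\<close>

lemma expectation_count_chunks_le:
  assumes fin: "finite (set_pmf p)" and l: "l > 0" and q: "0 \<le> q"
    and le: "\<And>k. k \<le> l \<Longrightarrow> measure_pmf.expectation (replicate_pmf k p) (\<lambda>z. of_bool (P z)) \<le> q"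
  shows "measure_pmf.expectation (replicate_pmf n p) (\<lambda>z. real (length (filter P (chunks l z))))
    \<le> (real n / real l + 1) * q"
proof (induction n rule: less_induct)
  case (less n)
  let ?c = "\<lambda>z. real (length (filter P (chunks l z)))"
  let ?E = "\<lambda>n. measure_pmf.expectation (replicate_pmf n p)"
  show ?case
  proof (cases "n \<le> l")
    case True
    \<comment> \<open>Not an equality: the empty word has no chunk but may satisfy
      \<open>P\<close>.\<close>
    have "?c z \<le> of_bool (P z)" if "length z = n" for z
      using that True l by (cases "z = []") (auto simp: chunks_nonempty)
    then have "?E n ?c \<le> ?E n (\<lambda>z. of_bool (P z))"
      by (intro expectation_mono_pmf finite_set_replicate_pmf fin) (auto simp: set_replicate_pmf)
    also have "\<dots> \<le> 1 * q" using le True by simp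
    also have "\<dots> \<le> (real n / real l + 1) * q" by (intro mult_right_mono q) simp
    finally show ?thesis .
  next
    case False
    have "?c (xs @ ys) = of_bool (P xs) + ?c ys" if "length xs = l" for xs ys
      using that l by (subst chunks_nonempty) auto
    then have "?E (l + (n - l)) ?c = ?E l (\<lambda>z. of_bool (P z)) + ?E (n - l) ?c"
      by (intro expectation_replicate_pmf_append fin) auto
    also have "\<dots> \<le> q + (real (n - l) / real l + 1) * q"
      using False l by (intro add_mono le less) auto
    also have "\<dots> = (real n / real l + 1) * q"
      using False l by (simp add: of_nat_diff field_simps)
    finally show ?thesis using False by simp
  qed
qed

lemma expectation_count_mfld_chunks_le:
  assumes fin: "finite (set_pmf p)" and l: "l > 0" and q: "0 \<le> q" and D: "D > 0"
    and le: "\<And>k. k \<le> l \<Longrightarrow> measure_pmf.expectation (replicate_pmf k p) (\<lambda>z. of_bool (P z)) \<le> q"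
  shows "measure_pmf.expectation (replicate_pmf (B * D) p)
      (\<lambda>z. real (length (filter P (mfld_chunks D l z)))) \<le> real B * ((real D / real l + 1) * q)"
proof (induction B)
  case 0
  then show ?case by simp
next
  case (Suc B)
  let ?c = "\<lambda>z. real (length (filter P (mfld_chunks D l z)))"
  let ?E = "\<lambda>n. measure_pmf.expectation (replicate_pmf n p)"
  have "?E (D + B * D) ?c = ?E D (\<lambda>z. real (length (filter P (chunks l z)))) + ?E (B * D) ?c"
    by (intro expectation_replicate_pmf_append fin) (simp add: mfld_chunks_append D)
  then show ?case
    using expectation_count_chunks_le[of p l q P D] Suc assms by (simp add: algebra_simps add_divide_distrib)
qed

section \<open>Weight of noise words\<close>

abbreviation "weight z \<equiv> count_list z True"

text \<open>The probability generating function of the binomial distribution, the moment used in the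
  Chernoff bound.\<close>

lemma expectation_power_weight:
  assumes "0 \<le> \<delta>" "\<delta> \<le> 1"
  shows "measure_pmf.expectation (replicate_pmf n (bernoulli_pmf \<delta>)) (\<lambda>z. u ^ weight z)
    = (1 - \<delta> + \<delta> * u) ^ n"
proof (induction n)
  case (Suc n)
  then show ?case
    using assms by (subst expectation_replicate_pmf_Suc) (simp_all add: algebra_simps)
qed simp

lemma expectation_weight:
  assumes "0 \<le> \<delta>" "\<delta> \<le> 1"
  shows "measure_pmf.expectation (replicate_pmf n (bernoulli_pmf \<delta>)) (\<lambda>z. real (weight z))
    = real n * \<delta>"
proof (induction n)
  case (Suc n)
  then show ?case
    using assms by (subst expectation_replicate_pmf_Suc)
      (simp_all add: algebra_simps expectation_add_pmf)
qed simp

text \<open>Written with the odds \<open>\<delta> / (1 - \<delta>)\<close> so that weight and length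
  sit in separate factors; for \<delta> below 1/2 both bases are below 1.\<close>

lemma pmf_replicate_bernoulli:
  assumes "0 < \<delta>" "\<delta> < 1"
  shows "pmf (replicate_pmf (length z) (bernoulli_pmf \<delta>)) z = (\<delta> / (1 - \<delta>)) ^ weight z * (1 - \<delta>) ^ length z"
proof (induction z)
  case (Cons b z)
  have "replicate_pmf (Suc n) p = map_pmf (\<lambda>(x, xs). x # xs) (pair_pmf p (replicate_pmf n p))"
    for n and p :: "bool pmf"
    by (simp add: pair_pmf_def map_pmf_def bind_assoc_pmf bind_return_pmf)
  then have "pmf (replicate_pmf (length (b # z)) (bernoulli_pmf \<delta>)) (b # z)
      = pmf (map_pmf (\<lambda>(x, xs). x # xs) (pair_pmf (bernoulli_pmf \<delta>)
          (replicate_pmf (length z) (bernoulli_pmf \<delta>)))) ((\<lambda>(x, xs). x # xs) (b, z))"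
    by simp
  also have "\<dots> = pmf (bernoulli_pmf \<delta>) b * pmf (replicate_pmf (length z) (bernoulli_pmf \<delta>)) z"
    by (subst pmf_map_inj') (auto simp: inj_def pmf_pair)
  finally show ?case using assms Cons by (cases b) simp_all
qed simp

lemma sum_pmf_le_1: "finite S \<Longrightarrow> sum (pmf p) S \<le> 1"
  by (metis measure_measure_pmf_finite measure_pmf.prob_le_1)

text \<open>Each such word has probability at least
  \<open>2 powr (- (real l * cross_entropy \<gamma> \<delta>))\<close>, and the probabilities add up
  to at most 1. The threshold is relative to \<open>l\<close> even for shorter words, so that one
  bound serves all chunks of a segment.\<close>

lemma card_low_weight_le:
  assumes "0 < \<delta>" "\<delta> < 1 / 2" "k \<le> l"
  shows "real (card {z. length z = k \<and> real (weight z) \<le> \<gamma> * real l})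
    \<le> 2 powr (real l * cross_entropy \<gamma> \<delta>)"
proof -
  let ?S = "{z. length z = k \<and> real (weight z) \<le> \<gamma> * real l}"
  let ?p = "replicate_pmf k (bernoulli_pmf \<delta>)"
  have fin: "finite ?S" by (rule finite_subset[of _ "{z. length z = k}"]) auto
  have log: "log 2 (1 / \<delta>) = - log 2 \<delta>" "log 2 (1 / (1 - \<delta>)) = - log 2 (1 - \<delta>)"
    using assms by (simp_all add: log_divide)
  have "2 powr (- (real l * cross_entropy \<gamma> \<delta>)) \<le> pmf ?p z" if z: "z \<in> ?S" for z
  proof -
    have "2 powr (- (real l * cross_entropy \<gamma> \<delta>))
        = 2 powr (log 2 (\<delta> / (1 - \<delta>)) * (\<gamma> * real l) + log 2 (1 - \<delta>) * real l)"
      using assms by (simp add: cross_entropy_def log log_divide algebra_simps)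
    also have "\<dots> = (\<delta> / (1 - \<delta>)) powr (\<gamma> * real l) * (1 - \<delta>) powr real l"
      using assms by (simp add: powr_add flip: powr_powr)
    \<comment> \<open>Both bases are below 1, so the smaller exponents \<open>weight z\<close> and
      \<open>k\<close> can only increase the product.\<close>
    also have "\<dots> \<le> (\<delta> / (1 - \<delta>)) powr real (weight z) * (1 - \<delta>) powr real k"
      using assms z by (intro mult_mono powr_mono') auto
    also have "\<dots> = pmf ?p z"
      using z pmf_replicate_bernoulli[of \<delta> z] assms by (simp add: powr_realpow)
    finally show ?thesis .
  qed
  then have "(\<Sum>z\<in>?S. 2 powr (- (real l * cross_entropy \<gamma> \<delta>))) \<le> sum (pmf ?p) ?S"
    by (intro sum_mono) auto
  also have "\<dots> \<le> 1" by (rule sum_pmf_le_1[OF fin])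
  finally show ?thesis by (simp add: powr_minus field_simps)
qed

text \<open>Markov's inequality for \<open>u ^ weight z\<close>. As
  \<open>1 - \<delta> + \<delta> * u\<close> is at least 1, raising its exponent from
  \<open>k\<close> to \<open>l\<close> makes the bound uniform in \<open>k\<close>.\<close>

lemma high_weight_prob_le:
  assumes "0 \<le> \<delta>" "\<delta> \<le> 1" "1 \<le> u" "k \<le> l"
  shows "measure_pmf.expectation (replicate_pmf k (bernoulli_pmf \<delta>))
      (\<lambda>z. of_bool (\<not> real (weight z) \<le> \<gamma> * real l)) \<le> ((1 - \<delta> + \<delta> * u) / u powr \<gamma>) ^ l"
proof -
  let ?p = "replicate_pmf k (bernoulli_pmf \<delta>)"
  have base: "1 \<le> 1 - \<delta> + \<delta> * u" using assms mult_left_mono[of 1 u \<delta>] by simp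
  have "measure_pmf.expectation ?p (\<lambda>z. of_bool (\<not> real (weight z) \<le> \<gamma> * real l))
      \<le> measure_pmf.expectation ?p (\<lambda>z. u ^ weight z / u powr (\<gamma> * real l))"
  proof (intro expectation_mono_pmf)
    fix z
    have "u powr (\<gamma> * real l) \<le> u ^ weight z" if "\<not> real (weight z) \<le> \<gamma> * real l"
      using that assms powr_mono[of "\<gamma> * real l" "real (weight z)" u] by (simp add: powr_realpow)
    then show "of_bool (\<not> real (weight z) \<le> \<gamma> * real l) \<le> u ^ weight z / u powr (\<gamma> * real l)"
      using assms by simp
  qed simp
  also have "\<dots> = (1 - \<delta> + \<delta> * u) ^ k / u powr (\<gamma> * real l)"
    using assms by (simp add: expectation_power_weight)
  also have "\<dots> \<le> (1 - \<delta> + \<delta> * u) ^ l / u powr (\<gamma> * real l)"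
    using assms base by (intro divide_right_mono power_increasing) auto
  also have "u powr (\<gamma> * real l) = (u powr \<gamma>) ^ l"
    using assms by (simp add: powr_powr[symmetric] powr_realpow)
  finally show ?thesis by (simp add: power_divide)
qed

text \<open>Numerator and denominator both equal 1 at \<open>u = 1\<close>, where the denominator
  has the larger slope, \<gamma> against \<delta>; a slightly larger \<open>u\<close> suffices,
  without optimising.\<close>

lemma chernoff_base_exists:
  assumes "0 < \<delta>" "\<delta> < \<gamma>"
  shows "\<exists>u\<ge>1. (1 - \<delta> + \<delta> * u) / u powr \<gamma> < (1 :: real)"
proof -
  have "((\<lambda>u. u powr \<gamma> - (1 - \<delta> + \<delta> * u)) has_real_derivative \<gamma> - \<delta>) (at 1)"
    by (auto intro!: derivative_eq_intros)
  from DERIV_pos_inc_right[OF this] assms obtain d where d: "d > 0"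
    and inc: "\<And>h. 0 < h \<Longrightarrow> h < d \<Longrightarrow> 0 < (1 + h) powr \<gamma> - (1 - \<delta> + \<delta> * (1 + h))"
    by auto
  from inc[of "d / 2"] d show ?thesis by (intro exI[of _ "1 + d / 2"]) (auto simp: field_simps)
qed

text \<open>An entry of \<open>ps\<close> pairs the bits of a clean chunk with its noise bits. A
  noisy chunk whose noise satisfies \<open>P\<close> is one of at most \<open>M\<close> neighbours
  of a clean chunk, so repeated clean chunks cost nothing more; the other noisy chunks are counted
  one by one.\<close>

lemma card_set_noisy_chunks_le:
  fixes ps :: "(bool \<times> bool) list list"
  assumes "\<And>k. k \<le> l \<Longrightarrow> real (card {z. length z = k \<and> P z}) \<le> M" "\<forall>p\<in>set ps. length p \<le> l"
  shows "real (card (set (map (map (case_prod (\<noteq>))) ps)))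
    \<le> real (card (set (map (map fst) ps))) * M
      + real (length (filter (\<lambda>z. \<not> P z) (map (map snd) ps)))"
proof -
  let ?near = "\<lambda>x. map2 (\<noteq>) x ` {z. length z = length x \<and> P z}"
  let ?X = "set (map (map fst) ps)"
  let ?far = "map (map (case_prod (\<noteq>))) (filter (\<lambda>p. \<not> P (map snd p)) ps)"
  have fin: "finite {z :: bool list. length z = k \<and> P z}" for k
    by (rule finite_subset[of _ "{z. length z = k}"]) auto
  have "set (map (map (case_prod (\<noteq>))) ps) \<subseteq> (\<Union>x\<in>?X. ?near x) \<union> set ?far"
  proof
    fix c assume "c \<in> set (map (map (case_prod (\<noteq>))) ps)"
    then obtain p where p: "p \<in> set ps" "c = map (case_prod (\<noteq>)) p" by auto
    show "c \<in> (\<Union>x\<in>?X. ?near x) \<union> set ?far"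
    proof (cases "P (map snd p)")
      case True
      have "c = map2 (\<noteq>) (map fst p) (map snd p)" by (simp add: p zip_map_fst_snd)
      then have "c \<in> ?near (map fst p)" using True by auto
      then show ?thesis using p by auto
    next
      case False
      then show ?thesis using p by auto
    qed
  qed
  then have "card (set (map (map (case_prod (\<noteq>))) ps)) \<le> card ((\<Union>x\<in>?X. ?near x) \<union> set ?far)"
    by (intro card_mono) (auto simp: fin)
  also have "\<dots> \<le> card (\<Union>x\<in>?X. ?near x) + card (set ?far)" by (rule card_Un_le)
  also have "\<dots> \<le> (\<Sum>x\<in>?X. card (?near x)) + length ?far"
    by (intro add_mono card_UN_le card_length) simp
  finally have "real (card (set (map (map (case_prod (\<noteq>))) ps)))
      \<le> (\<Sum>x\<in>?X. real (card (?near x))) + real (length ?far)"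
    by (simp flip: of_nat_sum of_nat_add)
  also have "(\<Sum>x\<in>?X. real (card (?near x))) \<le> (\<Sum>x\<in>?X. M)"
  proof (intro sum_mono)
    fix x assume "x \<in> ?X"
    then have "length x \<le> l" using assms(2) by auto
    have "real (card (?near x)) \<le> real (card {z. length z = length x \<and> P z})"
      by (simp add: card_image_le fin)
    also have "\<dots> \<le> M" by (rule assms(1)) fact
    finally show "real (card (?near x)) \<le> M" .
  qed
  finally show ?thesis by (simp add: filter_map comp_def)
qed

section \<open>Entropy and expected encoding length of the source\<close>

lemma edit_pmf_Nil [simp]: "edit_pmf \<delta> [] = return_pmf []"
  by (simp add: edit_pmf_def)

lemma edit_pmf_Cons:
  "edit_pmf \<delta> (b # w)
    = do {z \<leftarrow> bernoulli_pmf \<delta>; a \<leftarrow> edit_pmf \<delta> w; return_pmf ((b \<noteq> z) # a)}"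
  by (simp add: edit_pmf_def map_pmf_def bind_assoc_pmf bind_return_pmf)

lemma edit_pmf_append:
  "edit_pmf \<delta> (v @ w) = do {a \<leftarrow> edit_pmf \<delta> v; b \<leftarrow> edit_pmf \<delta> w; return_pmf (a @ b)}"
  by (induction v) (simp_all add: edit_pmf_Cons bind_assoc_pmf bind_return_pmf bind_return_pmf')

lemma finite_set_edit_pmf [simp]: "finite (set_pmf (edit_pmf \<delta> w))"
  by (simp add: edit_pmf_def)

lemma length_edit_pmf: "y \<in> set_pmf (edit_pmf \<delta> w) \<Longrightarrow> length y = length w"
  by (auto simp: edit_pmf_def set_replicate_pmf)

text \<open>The noise on one block is independent of the indices drawn later, so all indices can be
  drawn first and the concatenated word edited at once.\<close>

lemma map_concat_replicate_edit_pmf: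
  "map_pmf concat (replicate_pmf n (P \<bind> (\<lambda>j. edit_pmf \<delta> (f j))))
    = replicate_pmf n P \<bind> (\<lambda>js. edit_pmf \<delta> (concat (map f js)))"
proof (induction n)
  case 0
  then show ?case by (simp add: bind_return_pmf)
next
  case (Suc n)
  let ?R = "replicate_pmf n (P \<bind> (\<lambda>j. edit_pmf \<delta> (f j)))"
  have "map_pmf concat (replicate_pmf (Suc n) (P \<bind> (\<lambda>j. edit_pmf \<delta> (f j))))
      = do {j \<leftarrow> P; y \<leftarrow> edit_pmf \<delta> (f j); r \<leftarrow> map_pmf concat ?R; return_pmf (y @ r)}"
    by (simp add: map_pmf_def bind_assoc_pmf bind_return_pmf)
  also have "\<dots> = do {j \<leftarrow> P; y \<leftarrow> edit_pmf \<delta> (f j); js \<leftarrow> replicate_pmf n P;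
      r \<leftarrow> edit_pmf \<delta> (concat (map f js)); return_pmf (y @ r)}"
    by (simp add: Suc bind_assoc_pmf)
  also have "\<dots> = do {j \<leftarrow> P; js \<leftarrow> replicate_pmf n P; y \<leftarrow> edit_pmf \<delta> (f j);
      r \<leftarrow> edit_pmf \<delta> (concat (map f js)); return_pmf (y @ r)}"
    by (subst bind_commute_pmf) (rule refl)
  finally show ?case by (simp add: bind_assoc_pmf bind_return_pmf edit_pmf_append)
qed

section \<open>The stream before the edits\<close>

definition clean_source_pmf :: "nat \<Rightarrow> nat \<Rightarrow> nat \<Rightarrow> bool list pmf" where
  "clean_source_pmf A B L = do {
     X \<leftarrow> replicate_pmf A (pmf_of_set {x. length x = L});
     js \<leftarrow> replicate_pmf B (pmf_of_set {..<A});
     return_pmf (concat (map ((!) X) js))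
   }"

text \<open>Exhibits the stream as a mixture of edit channel outputs; the lower bound on entropy and
  the upper bound on length are then proved for each clean word separately.\<close>

lemma source_pmf_eq_edit: "source_pmf A B L \<delta> = clean_source_pmf A B L \<bind> edit_pmf \<delta>"
proof -
  have "source_pmf A B L \<delta> = replicate_pmf A (pmf_of_set {x. length x = L}) \<bind>
      (\<lambda>X. map_pmf concat (replicate_pmf B (pmf_of_set {..<A} \<bind> (\<lambda>j. edit_pmf \<delta> (X ! j)))))"
    by (simp add: source_pmf_def map_pmf_def)
  then show ?thesis
    by (simp add: map_concat_replicate_edit_pmf clean_source_pmf_def bind_assoc_pmf bind_return_pmf)
qed

lemma set_pmf_of_bool_lists [simp]:
  "set_pmf (pmf_of_set {x :: bool list. length x = n}) = {x. length x = n}"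
proof -
  have "{x :: bool list. length x = n} \<noteq> {}" using length_replicate[of n True] by blast
  then show ?thesis by simp
qed

lemma set_pmf_of_lessThan [simp]: "A > 0 \<Longrightarrow> set_pmf (pmf_of_set {..<A :: nat}) = {..<A}"
  by (simp add: lessThan_empty_iff)

lemma finite_set_clean_source_pmf:
  assumes "A > 0"
  shows "finite (set_pmf (clean_source_pmf A B L))"
  using assms by (simp add: clean_source_pmf_def)

text \<open>The length estimate will hold for every realisation of symbols and indices; the count of
  distinct blocks is the only trace of repetition that it uses.\<close>

lemma set_clean_source_pmf:
  assumes "A > 0" "w \<in> set_pmf (clean_source_pmf A B L)"
  obtains ws where "w = concat ws" "length ws = B" "card (set ws) \<le> A" "\<forall>x\<in>set ws. length x = L"
proof -
  from assms obtain X js where X: "length X = A" "\<forall>x\<in>set X. length x = L"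
    and js: "length js = B" "set js \<subseteq> {..<A}" and w: "w = concat (map ((!) X) js)"
    by (auto simp: clean_source_pmf_def set_replicate_pmf lists_eq_set)
  have "card (set (map ((!) X) js)) \<le> card (set js)"
    by (simp add: card_image_le)
  also have "\<dots> \<le> A" using card_mono[OF _ js(2)] by simp
  finally show ?thesis
    using X js w by (intro that[of "map ((!) X) js"]) auto
qed

lemma length_clean_source_pmf:
  assumes "A > 0" "w \<in> set_pmf (clean_source_pmf A B L)"
  shows "length w = B * L"
proof -
  from assms obtain ws where "w = concat ws" "length ws = B" "\<forall>x\<in>set ws. length x = L"
    by (rule set_clean_source_pmf)
  then show ?thesis by (induction ws arbitrary: w B) auto
qed

lemma finite_set_source_pmf: "A > 0 \<Longrightarrow> finite (set_pmf (source_pmf A B L \<delta>))"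
  by (simp add: source_pmf_eq_edit finite_set_clean_source_pmf)

lemma length_source_pmf:
  "A > 0 \<Longrightarrow> s \<in> set_pmf (source_pmf A B L \<delta>) \<Longrightarrow> length s = B * L"
  by (auto simp: source_pmf_eq_edit length_edit_pmf length_clean_source_pmf)

section \<open>Entropy bounds\<close>

lemma pmf_entropy_eq_expectation:
  fixes p :: "'a::countable pmf"
  assumes "finite (set_pmf p)"
  shows "pmf_entropy p = measure_pmf.expectation p (\<lambda>x. log 2 (1 / pmf p x))"
  using assms by (simp add: pmf_entropy_eq_sum integral_measure_pmf[of "set_pmf p"])

text \<open>Gibbs' inequality, from \<open>ln t \<le> t - 1\<close>. The weights \<open>q\<close>
  need only sum to at most 1, as Kraft's inequality gives no more.\<close>

lemma pmf_entropy_le_cross: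
  fixes p :: "'a::countable pmf"
  assumes fin: "finite (set_pmf p)" and pos: "\<And>x. x \<in> set_pmf p \<Longrightarrow> q x > 0"
    and le: "sum q (set_pmf p) \<le> 1"
  shows "pmf_entropy p \<le> measure_pmf.expectation p (\<lambda>x. log 2 (1 / q x))"
proof -
  let ?S = "set_pmf p"
  have "pmf p x * log 2 (1 / pmf p x) - pmf p x * log 2 (1 / q x) \<le> (q x - pmf p x) / ln 2"
    if "x \<in> ?S" for x
  proof -
    have p: "pmf p x > 0" using that by (simp add: pmf_positive)
    have "pmf p x * log 2 (1 / pmf p x) - pmf p x * log 2 (1 / q x)
        = pmf p x * (ln (q x / pmf p x) / ln 2)"
      using p pos[OF that] by (simp add: log_def ln_div field_simps)
    also have "\<dots> \<le> pmf p x * ((q x / pmf p x - 1) / ln 2)"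
      using p pos[OF that] by (intro mult_left_mono divide_right_mono ln_le_minus_one) auto
    also have "\<dots> = (q x - pmf p x) / ln 2" using p by (simp add: field_simps)
    finally show ?thesis .
  qed
  then have "(\<Sum>x\<in>?S. pmf p x * log 2 (1 / pmf p x) - pmf p x * log 2 (1 / q x))
      \<le> (\<Sum>x\<in>?S. (q x - pmf p x) / ln 2)"
    by (rule sum_mono)
  also have "\<dots> = (sum q ?S - sum (pmf p) ?S) / ln 2"
    by (simp add: sum_divide_distrib[symmetric] sum_subtractf)
  also have "\<dots> \<le> 0"
    using le sum_pmf_eq_1[OF fin order_refl] by (simp add: field_simps)
  finally show ?thesis
    using fin by (simp add: pmf_entropy_eq_sum sum_subtractf integral_measure_pmf[of ?S])
qed

text \<open>Concavity of entropy. By Gibbs' inequality the entropy of each \<open>K w\<close> is at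
  most its cross entropy against the mixture, and averaging these cross entropies over
  \<open>W\<close> gives the entropy of the mixture.\<close>

lemma pmf_entropy_bind_ge:
  fixes K :: "'b \<Rightarrow> 'a::countable pmf"
  assumes "finite (set_pmf W)" "\<And>w. w \<in> set_pmf W \<Longrightarrow> finite (set_pmf (K w))"
    and "\<And>w. w \<in> set_pmf W \<Longrightarrow> h \<le> pmf_entropy (K w)"
  shows "h \<le> pmf_entropy (W \<bind> K)"
proof -
  let ?q = "pmf (W \<bind> K)"
  have "h \<le> measure_pmf.expectation (K w) (\<lambda>x. log 2 (1 / ?q x))" if w: "w \<in> set_pmf W" for w
  proof -
    have "h \<le> pmf_entropy (K w)" by (rule assms(3)) fact
    also have "\<dots> \<le> measure_pmf.expectation (K w) (\<lambda>x. log 2 (1 / ?q x))"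
      using w assms by (intro pmf_entropy_le_cross sum_pmf_le_1) (auto simp: pmf_positive_iff)
    finally show ?thesis .
  qed
  then have "h \<le> measure_pmf.expectation W (\<lambda>w. measure_pmf.expectation (K w) (\<lambda>x. log 2 (1 / ?q x)))"
    by (intro expectation_ge_const_pmf[OF assms(1)])
  then show ?thesis
    using assms by (simp add: pmf_entropy_eq_expectation expectation_bind_pmf)
qed

lemma inj_on_xor:
  fixes w :: "bool list"
  shows "inj_on (map2 (\<noteq>) w) {z. length z = length w}"
proof (rule inj_on_inverseI)
  show "map2 (\<noteq>) w (map2 (\<noteq>) w z) = z" if "z \<in> {z. length z = length w}" for z
    using that by (auto intro!: nth_equalityI)
qed

text \<open>Adding \<open>w\<close> is injective on noise words, so an output has the probability of
  its noise word. The logarithm of that is affine in the weight, whose mean is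
  \<open>length w * \<delta>\<close>.\<close>

lemma pmf_entropy_edit_pmf:
  assumes "0 < \<delta>" "\<delta> < 1"
  shows "pmf_entropy (edit_pmf \<delta> w) = real (length w) * bin_entropy \<delta>"
proof -
  let ?n = "length w"
  let ?r = "replicate_pmf ?n (bernoulli_pmf \<delta>)"
  have "log 2 (1 / pmf (edit_pmf \<delta> w) (map2 (\<noteq>) w z))
      = real (weight z) * log 2 ((1 - \<delta>) / \<delta>) + real ?n * log 2 (1 / (1 - \<delta>))"
    if z: "z \<in> set_pmf ?r" for z
  proof -
    have len: "length z = ?n" using z by (simp add: set_replicate_pmf)
    have "pmf (edit_pmf \<delta> w) (map2 (\<noteq>) w z) = pmf ?r z"
      unfolding edit_pmf_def using z
      by (intro pmf_map_inj inj_on_subset[OF inj_on_xor]) (auto simp: set_replicate_pmf)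
    also have "\<dots> = (\<delta> / (1 - \<delta>)) ^ weight z * (1 - \<delta>) ^ ?n"
      using pmf_replicate_bernoulli[OF assms, of z] len by simp
    finally show ?thesis
      using assms by (simp add: log_divide log_mult log_nat_power algebra_simps)
  qed
  then have "pmf_entropy (edit_pmf \<delta> w) = measure_pmf.expectation ?r
      (\<lambda>z. real (weight z) * log 2 ((1 - \<delta>) / \<delta>) + real ?n * log 2 (1 / (1 - \<delta>)))"
    by (subst pmf_entropy_eq_expectation, simp)
       (subst edit_pmf_def, simp, intro expectation_cong_pmf, simp)
  also have "\<dots> = real ?n * \<delta> * log 2 ((1 - \<delta>) / \<delta>) + real ?n * log 2 (1 / (1 - \<delta>))"
    using assms by (simp add: expectation_add_pmf expectation_weight)
  also have "\<dots> = real ?n * bin_entropy \<delta>"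
    using assms by (simp add: bin_entropy_def log_divide algebra_simps)
  finally show ?thesis .
qed

lemma pmf_entropy_source_ge:
  assumes "0 < \<delta>" "\<delta> < 1" "A > 0"
  shows "real (B * L) * bin_entropy \<delta> \<le> pmf_entropy (source_pmf A B L \<delta>)"
  unfolding source_pmf_eq_edit
proof (rule pmf_entropy_bind_ge)
  fix w assume "w \<in> set_pmf (clean_source_pmf A B L)"
  then have "length w = B * L" using assms length_clean_source_pmf by blast
  then show "real (B * L) * bin_entropy \<delta> \<le> pmf_entropy (edit_pmf \<delta> w)"
    using pmf_entropy_edit_pmf[OF assms(1,2), of w] by simp
qed (simp_all add: finite_set_clean_source_pmf assms)

text \<open>Gibbs' inequality with weights \<open>(1/2) ^ length\<close>. All outputs of the source
  have length \<open>B * L\<close>, so Kraft's inequality for this single length is enough.\<close>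

lemma pmf_entropy_source_le:
  assumes "A > 0" "D > 0" "l > 0"
  shows "pmf_entropy (source_pmf A B L \<delta>)
    \<le> measure_pmf.expectation (source_pmf A B L \<delta>) (\<lambda>s. real (length (mfld_encode D l s)))"
proof -
  let ?p = "source_pmf A B L \<delta>"
  let ?q = "\<lambda>s. (1/2 :: real) ^ length (mfld_encode D l s)"
  have "sum ?q (set_pmf ?p) \<le> sum ?q {s. length s = B * L}"
    using assms by (intro sum_mono2) (auto simp: length_source_pmf)
  also have "\<dots> \<le> 1" by (rule mfld_encode_kraft) fact+
  finally have "pmf_entropy ?p \<le> measure_pmf.expectation ?p (\<lambda>s. log 2 (1 / ?q s))"
    by (intro pmf_entropy_le_cross finite_set_source_pmf assms) auto
  moreover have "log 2 (1 / ?q s) = real (length (mfld_encode D l s))" for s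
    by (simp add: power_divide log_nat_power)
  ultimately show ?thesis by simp
qed

text \<open>Segments of length \<open>L\<close> coincide with the source blocks, so a symbol gives
  the same clean chunks whenever it recurs. Here \<open>m\<close> bounds the chunks per block; the
  factor \<open>real l\<close> multiplies the number of new chunks, first near copies, then chunks
  with heavy noise. The threshold \<gamma> and the Chernoff parameter \<open>u\<close> stay
  free.\<close>

lemma expectation_mfld_encode_le:
  assumes \<delta>: "0 < \<delta>" "\<delta> < 1 / 2" and u: "1 \<le> u" and pos: "A > 0" "B > 0" "L > 0" "l > 0"
  defines "m \<equiv> real L / real l + 1"
  shows "measure_pmf.expectation (source_pmf A B L \<delta>) (\<lambda>s. real (length (mfld_encode L l s)))
    \<le> 2 * log 2 (real B * real L) + 1 + real B * m * (3 + log 2 (real B * real L))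
      + real l * (real A * m * 2 powr (real l * cross_entropy \<gamma> \<delta>)
        + real B * m * ((1 - \<delta> + \<delta> * u) / u powr \<gamma>) ^ l)"
    (is "_ \<le> ?rhs")
proof -
  define n where "n = B * L"
  define near where "near z \<longleftrightarrow> real (weight z) \<le> \<gamma> * real l" for z
  define M where "M = 2 powr (real l * cross_entropy \<gamma> \<delta>)"
  define q where "q = ((1 - \<delta> + \<delta> * u) / u powr \<gamma>) ^ l"
  define N where "N = real B * m"
  let ?r = "replicate_pmf n (bernoulli_pmf \<delta>)"
  have q0: "0 \<le> q" unfolding q_def using \<delta> u by (intro zero_le_power divide_nonneg_nonneg) auto
  have m1: "1 \<le> m" unfolding m_def by simp
  have N1: "1 \<le> N" using m1 pos mult_mono[of 1 "real B" 1 m] by (simp add: N_def)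
  have n0: "n > 0" using pos by (simp add: n_def)
  \<comment> \<open>\<open>N\<close> is at most twice the stream length, which turns
    \<open>2 + log 2 N\<close> into \<open>3 + log 2 n\<close>.\<close>
  have "real L / real l \<le> real L" using pos by (simp add: field_simps)
  then have "m \<le> real L * 2" unfolding m_def using pos by simp
  then have "N \<le> real n * 2"
    unfolding N_def n_def using mult_left_mono[of m "real L * 2" "real B"] by simp
  then have "log 2 N \<le> log 2 (real n * 2)" using N1 n0 by simp
  also have "\<dots> = log 2 (real n) + 1" using n0 by (simp add: log_mult)
  finally have logN: "log 2 N \<le> log 2 (real n) + 1" .
  have "measure_pmf.expectation (edit_pmf \<delta> w) (\<lambda>s. real (length (mfld_encode L l s))) \<le> ?rhs"
    if "w \<in> set_pmf (clean_source_pmf A B L)" for w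
  proof -
    from that pos obtain ws where ws: "w = concat ws" "length ws = B" "card (set ws) \<le> A"
        "\<forall>x\<in>set ws. length x = L"
      using set_clean_source_pmf by metis
    have lw: "length w = n" unfolding n_def using length_clean_source_pmf that pos by blast
    have mw: "mfld_chunks L l w = concat (map (chunks l) ws)"
      unfolding ws(1) by (rule mfld_chunks_concat) (use ws pos in auto)
    have chunks_le: "real (length (chunks l x)) \<le> m" if "x \<in> set ws" for x
      using length_chunks_le[OF pos(4), of x] ws(4) that by (simp add: m_def)
    \<comment> \<open>Repeated blocks contribute the same chunks, so summing over the set of blocks
      suffices.\<close>
    have cardX: "real (card (set (mfld_chunks L l w))) \<le> real A * m"
    proof -
      have "card (set (mfld_chunks L l w)) \<le> (\<Sum>x\<in>set ws. card (set (chunks l x)))"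
        unfolding mw by (simp add: card_UN_le)
      also have "\<dots> \<le> (\<Sum>x\<in>set ws. length (chunks l x))"
        by (intro sum_mono card_length)
      finally have "real (card (set (mfld_chunks L l w))) \<le> (\<Sum>x\<in>set ws. real (length (chunks l x)))"
        by (simp flip: of_nat_sum)
      also have "\<dots> \<le> (\<Sum>x\<in>set ws. m)" by (intro sum_mono chunks_le)
      also have "\<dots> \<le> real A * m" using ws(3) m1 by (simp add: mult_right_mono)
      finally show ?thesis .
    qed
    have lenN: "real (length (mfld_chunks L l w)) \<le> N"
    proof -
      have "real (length (mfld_chunks L l w)) = (\<Sum>x\<leftarrow>ws. real (length (chunks l x)))"
        unfolding mw by (simp add: length_concat comp_def flip: sum_list_of_nat)
      also have "\<dots> \<le> (\<Sum>x\<leftarrow>ws. m)" by (intro sum_list_mono chunks_le)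
      finally show ?thesis by (simp add: sum_list_triv ws N_def)
    qed
    \<comment> \<open>Pointwise in the noise word; only the last summand depends on
      \<open>z\<close>.\<close>
    have bound: "real (length (mfld_encode L l (map2 (\<noteq>) w z)))
        \<le> 2 * log 2 n + 1 + N * (2 + log 2 N) + real l * (real A * m * M)
          + real l * real (length (filter (\<lambda>z. \<not> near z) (mfld_chunks L l z)))"
      if z: "length z = n" for z
    proof -
      let ?ps = "mfld_chunks L l (zip w z)"
      have fst: "map (map fst) ?ps = mfld_chunks L l w" and snd: "map (map snd) ?ps = mfld_chunks L l z"
        using z lw by (simp_all flip: mfld_chunks_map)
      have xor: "map (map (case_prod (\<noteq>))) ?ps = mfld_chunks L l (map2 (\<noteq>) w z)"
        by (simp flip: mfld_chunks_map)
      have "real (card (set (map (map (case_prod (\<noteq>))) ?ps)))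
          \<le> real (card (set (map (map fst) ?ps))) * M
            + real (length (filter (\<lambda>z. \<not> near z) (map (map snd) ?ps)))"
      proof (rule card_set_noisy_chunks_le)
        show "real (card {z. length z = k \<and> near z}) \<le> M" if "k \<le> l" for k
          unfolding near_def M_def using \<delta> that by (intro card_low_weight_le) auto
      qed (auto simp: length_in_mfld_chunks_le)
      also have "\<dots> \<le> real A * m * M + real (length (filter (\<lambda>z. \<not> near z) (mfld_chunks L l z)))"
        unfolding fst snd using cardX by (intro add_mono mult_right_mono) (auto simp: M_def)
      finally have "real (card (set (mfld_chunks L l (map2 (\<noteq>) w z))))
          \<le> real A * m * M + real (length (filter (\<lambda>z. \<not> near z) (mfld_chunks L l z)))"
        unfolding xor .
      then have "real l * real (card (set (mfld_chunks L l (map2 (\<noteq>) w z))))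
          \<le> real l * (real A * m * M)
            + real l * real (length (filter (\<lambda>z. \<not> near z) (mfld_chunks L l z)))"
        by (simp add: mult_left_mono flip: distrib_left)
      \<comment> \<open>The edited word has as many chunks as the clean one, so \<open>lenN\<close>
        carries over.\<close>
      moreover have "length (mfld_chunks L l (map2 (\<noteq>) w z)) = length (mfld_chunks L l w)"
        unfolding xor[symmetric] fst[symmetric] by simp
      ultimately show ?thesis
        using length_mfld_encode_le[of "map2 (\<noteq>) w z" n L l N] z lw n0 pos lenN N1 by simp
    qed
    have "measure_pmf.expectation (edit_pmf \<delta> w) (\<lambda>s. real (length (mfld_encode L l s)))
        = measure_pmf.expectation ?r (\<lambda>z. real (length (mfld_encode L l (map2 (\<noteq>) w z))))"
      by (simp add: edit_pmf_def lw)
    also have "\<dots> \<le> measure_pmf.expectation ?r (\<lambda>z.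
        2 * log 2 n + 1 + N * (2 + log 2 N) + real l * (real A * m * M)
          + real l * real (length (filter (\<lambda>z. \<not> near z) (mfld_chunks L l z))))"
      by (intro expectation_mono_pmf bound) (auto simp: set_replicate_pmf intro: finite_lists_length_eq)
    also have "\<dots> = 2 * log 2 n + 1 + N * (2 + log 2 N) + real l * (real A * m * M)
          + real l * measure_pmf.expectation ?r
              (\<lambda>z. real (length (filter (\<lambda>z. \<not> near z) (mfld_chunks L l z))))"
      by (subst expectation_add_pmf) simp_all
    also have "\<dots> \<le> 2 * log 2 n + 1 + N * (3 + log 2 n) + real l * (real A * m * M)
          + real l * (real B * (m * q))"
    proof -
      have far: "measure_pmf.expectation ?r
          (\<lambda>z. real (length (filter (\<lambda>z. \<not> near z) (mfld_chunks L l z)))) \<le> real B * (m * q)"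
        unfolding n_def m_def
      proof (intro expectation_count_mfld_chunks_le q0 pos)
        show "measure_pmf.expectation (replicate_pmf k (bernoulli_pmf \<delta>))
            (\<lambda>z. of_bool (\<not> near z)) \<le> q" if "k \<le> l" for k
          unfolding near_def q_def using \<delta> u that by (intro high_weight_prob_le) auto
      qed simp
      have "N * (2 + log 2 N) \<le> N * (3 + log 2 n)"
        using logN N1 by (intro mult_left_mono) auto
      then show ?thesis using mult_left_mono[OF far, of "real l"] by simp
    qed
    also have "\<dots> = ?rhs"
      by (simp add: n_def N_def M_def q_def algebra_simps)
    finally show ?thesis .
  qed
  then show ?thesis
    unfolding source_pmf_eq_edit using pos
    by (subst expectation_bind_pmf) (auto intro: expectation_le_const_pmf finite_set_clean_source_pmf)
qed

section \<open>Asymptotics\<close>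

text \<open>Affine in the first argument, with slope
  \<open>log 2 ((1 - \<delta>) / \<delta>)\<close>, positive for \<delta> below 1/2.\<close>

lemma cross_entropy_strict_mono:
  assumes "0 < \<delta>" "\<delta> < 1 / 2" "\<gamma> < \<gamma>'"
  shows "cross_entropy \<gamma> \<delta> < cross_entropy \<gamma>' \<delta>"
proof -
  have "log 2 (1 / (1 - \<delta>)) < log 2 (1 / \<delta>)"
    using assms by (simp add: field_simps)
  then have "0 < (\<gamma>' - \<gamma>) * (log 2 (1 / \<delta>) - log 2 (1 / (1 - \<delta>)))"
    using assms by simp
  then show ?thesis by (simp add: cross_entropy_def algebra_simps)
qed

lemma bin_entropy_pos:
  assumes "0 < \<delta>" "\<delta> < 1"
  shows "0 < bin_entropy \<delta>"
  unfolding bin_entropy_def using assms by (intro add_pos_pos mult_pos_pos) simp_all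

lemma cross_entropy_pos:
  assumes "0 < \<delta>" "\<delta> < 1" "0 < \<gamma>" "\<gamma> < 1"
  shows "0 < cross_entropy \<gamma> \<delta>"
  unfolding cross_entropy_def using assms by (intro add_pos_pos mult_pos_pos) simp_all

text \<open>
  Per source bit and at \<open>x = B\<close>, the summands bound the cost of the Elias gamma code, the pointers and
  flags, and the new chunks; \<open>K1 x powr k1\<close> and \<open>K2 x powr k1\<close> enclose the symbol length.
\<close>

definition cost_rate :: "real \<Rightarrow> real \<Rightarrow> real \<Rightarrow> real \<Rightarrow> real \<Rightarrow> real \<Rightarrow> real \<Rightarrow> real \<Rightarrow> real" where
  "cost_rate K1 K2 k1 k2 c c' \<rho> x =
     (2 * (log 2 K2 + (1 + k1) * log 2 x) + 1) / x
     + (c / (k2 * log 2 x) + 1 / (K1 * x powr k1)) * (3 + log 2 K2 + (1 + k1) * log 2 x)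
     + 2 * (2 powr c' * x powr (- (k2 * (1 - c' / c))) + x powr (k2 / c * log 2 \<rho>))"

text \<open>The factors \<open>log 2 x\<close> cancel in the pointer term; the other two summands
  vanish.\<close>

lemma cost_rate_tendsto:
  assumes "0 < k1" "0 < k2" "0 < c" "c' < c" "0 < \<rho>" "\<rho> < 1" "0 < K1" "0 < K2"
  shows "(cost_rate K1 K2 k1 k2 c c' \<rho> \<longlongrightarrow> (1 + k1) / k2 * c) at_top"
proof -
  \<comment> \<open>\<open>a\<close> and \<open>b\<close> are the decay exponents of the near copies
    and of the heavy-noise chunks, positive because \<open>c' < c\<close> and
    \<open>\<rho> < 1\<close>.\<close>
  define a where "a = k2 * (1 - c' / c)"
  define b where "b = - (k2 / c * log 2 \<rho>)"
  have a: "0 < a" using assms by (simp add: a_def)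
  have "log 2 \<rho> < 0" using assms by simp
  then have b: "0 < b" using assms mult_pos_neg[of "k2 / c" "log 2 \<rho>"] by (simp add: b_def)
  define g where "g = log 2 K2"
  define e where "e = 2 powr c'"
  have "((\<lambda>x. (2 * (g + (1 + k1) * log 2 x) + 1) / x) \<longlongrightarrow> 0) at_top"
    using assms by real_asymp
  moreover have "((\<lambda>x. (c / (k2 * log 2 x) + 1 / (K1 * x powr k1)) * (3 + g + (1 + k1) * log 2 x))
      \<longlongrightarrow> (1 + k1) / k2 * c) at_top"
    using assms by (real_asymp simp: field_simps)
  moreover have "((\<lambda>x. 2 * (e * x powr (- a) + x powr (- b))) \<longlongrightarrow> 0) at_top"
  proof -
    have "((\<lambda>x :: real. x powr (- a)) \<longlongrightarrow> 0) at_top" "((\<lambda>x :: real. x powr (- b)) \<longlongrightarrow> 0) at_top"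
      using a b by real_asymp+
    then show ?thesis by (intro tendsto_mult_right_zero tendsto_add_zero)
  qed
  ultimately have "((\<lambda>x. (2 * (g + (1 + k1) * log 2 x) + 1) / x
     + (c / (k2 * log 2 x) + 1 / (K1 * x powr k1)) * (3 + g + (1 + k1) * log 2 x)
     + 2 * (e * x powr (- a) + x powr (- b))) \<longlongrightarrow> 0 + (1 + k1) / k2 * c + 0) at_top"
    by (intro tendsto_add)
  then show ?thesis unfolding cost_rate_def[abs_def] a_def b_def g_def e_def by simp
qed

text \<open>Arithmetic for one \<open>B\<close>: \<open>t1\<close>, \<open>t2\<close> and
  \<open>t5\<close> match the three summands of \<open>cost_rate\<close>. The lower bound on
  \<open>l\<close> limits the number of chunks and the heavy-noise fraction, the upper bound limits
  the near copies.\<close>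

lemma cost_le_cost_rate:
  fixes A B L l :: nat
  assumes c: "0 < c" "0 < c'" "c' < c" and \<rho>: "0 < \<rho>" "\<rho> < 1"
    and k: "0 < k1" "0 < k2" and K: "0 < K1" "0 < K2"
    and A: "A > 0" "real A \<le> real B powr (1 - k2)"
    and B: "B > 1" and L: "L > 0" "K1 * real B powr k1 \<le> real L" "real L \<le> K2 * real B powr k1"
    and l: "log 2 (real B / real A) / c \<le> real l" "real l \<le> log 2 (real B / real A) / c + 1" "l \<le> L"
  defines "m \<equiv> real L / real l + 1"
  shows "2 * log 2 (real B * real L) + 1 + real B * m * (3 + log 2 (real B * real L))
      + real l * (real A * m * 2 powr (real l * c') + real B * m * \<rho> ^ l)
    \<le> real B * real L * cost_rate K1 K2 k1 k2 c c' \<rho> (real B)"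
proof -
  define lb where "lb = log 2 (real B)"
  define lam where "lam = log 2 (real B / real A)"
  define LL where "LL = log 2 (real B * real L)"
  define G where "G = log 2 K2 + (1 + k1) * lb"
  have lb: "0 < lb" using B by (simp add: lb_def)
  \<comment> \<open>The growth bound on \<open>A\<close> turns \<open>log 2 (B / A)\<close> into at
    least a fixed multiple of \<open>log 2 B\<close>.\<close>
  have "log 2 (real A) \<le> (1 - k2) * lb"
    using A B log_mono[of 2 "real A" "real B powr (1 - k2)"] by (simp add: log_powr lb_def)
  then have lam: "k2 * lb \<le> lam"
    using A B by (simp add: lam_def lb_def log_divide algebra_simps)
  have k2lb: "0 < k2 * lb" using k lb by simp
  have lam0: "0 < lam" using lam k2lb by simp
  have l0: "0 < real l" using l(1) lam0 c by (smt (verit) divide_pos_pos lam_def)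
  have "log 2 (real L) \<le> log 2 (K2 * real B powr k1)" using L B K by simp
  also have "\<dots> = log 2 K2 + k1 * lb" using K B by (simp add: log_mult log_powr lb_def)
  finally have LLG: "LL \<le> G" using L B by (simp add: LL_def G_def log_mult lb_def algebra_simps)
  have BL: "1 \<le> real B * real L" using B L by (simp flip: of_nat_mult)
  have LL0: "0 \<le> LL" unfolding LL_def using BL by simp
  have Llm: "real l * m = real L + real l" using l0 by (simp add: m_def field_simps)
  have t1: "2 * LL + 1 \<le> real B * real L * ((2 * G + 1) / real B)"
  proof -
    have "2 * LL + 1 \<le> 1 * (2 * G + 1)" using LLG by simp
    also have "\<dots> \<le> real L * (2 * G + 1)" using L LLG LL0 by (intro mult_right_mono) auto
    finally show ?thesis using B by simp
  qed
  have t2: "real B * m * (3 + LL)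
      \<le> real B * real L * ((c / (k2 * lb) + 1 / (K1 * real B powr k1)) * (3 + G))"
  proof -
    have "1 / real l \<le> c / lam" using l(1) l0 lam0 c by (simp add: lam_def field_simps)
    also have "\<dots> \<le> c / (k2 * lb)" using lam k2lb c by (intro divide_left_mono) auto
    finally have i1: "1 / real l \<le> c / (k2 * lb)" .
    have i2: "1 / real L \<le> 1 / (K1 * real B powr k1)"
      using L K B by (intro divide_left_mono) auto
    have "m = real L * (1 / real l + 1 / real L)" using L l0 by (simp add: m_def field_simps)
    also have "\<dots> \<le> real L * (c / (k2 * lb) + 1 / (K1 * real B powr k1))"
      using i1 i2 by (intro mult_left_mono add_mono) auto
    finally have m: "m \<le> real L * (c / (k2 * lb) + 1 / (K1 * real B powr k1))" .
    have "0 \<le> m" by (simp add: m_def)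
    then have "m * (3 + LL) \<le> real L * (c / (k2 * lb) + 1 / (K1 * real B powr k1)) * (3 + G)"
      using m LLG LL0 by (intro mult_mono) auto
    then show ?thesis using mult_left_mono[of _ _ "real B"] by (simp add: mult.assoc)
  qed
  \<comment> \<open>As \<open>l \<le> L\<close>, the extra short chunk per block costs at most a
    factor 2.\<close>
  have lm2: "real l * m \<le> 2 * real L" using Llm l(3) by simp
  have lm0: "0 \<le> real l * m" using Llm by simp
  \<comment> \<open>Since \<open>A = B * 2 powr (- lam)\<close>, the exponent to bound is
    \<open>- lam + real l * c'\<close>; the factor \<open>2 powr c'\<close> pays for the ceiling in
    the chunk length.\<close>
  have t3: "real A * 2 powr (real l * c')
      \<le> real B * (2 powr c' * real B powr (- (k2 * (1 - c' / c))))"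
  proof -
    have A2: "real A = real B * 2 powr (- lam)"
      using A B by (simp add: lam_def powr_minus field_simps)
    have "real l * c' \<le> (lam / c + 1) * c'" using l(2) c by (simp add: lam_def)
    then have "- lam + real l * c' \<le> c' - lam * (1 - c' / c)" by (simp add: algebra_simps)
    also have "\<dots> \<le> c' - k2 * lb * (1 - c' / c)"
      using lam c by (intro diff_left_mono mult_right_mono) auto
    finally have e: "- lam + real l * c' \<le> c' + lb * (- (k2 * (1 - c' / c)))"
      by (simp add: algebra_simps)
    have "real A * 2 powr (real l * c') = real B * 2 powr (- lam + real l * c')"
      unfolding powr_add by (simp add: A2)
    also have "\<dots> \<le> real B * 2 powr (c' + lb * (- (k2 * (1 - c' / c))))"
      using e by (intro mult_left_mono powr_mono) auto
    also have "2 powr (c' + lb * (- (k2 * (1 - c' / c))))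
        = 2 powr c' * (2 powr lb) powr (- (k2 * (1 - c' / c)))"
      unfolding powr_add powr_powr ..
    finally show ?thesis using B by (simp add: lb_def)
  qed
  \<comment> \<open>\<open>log 2 \<rho>\<close> is negative, so a lower bound on \<open>l\<close>
    yields an upper bound on the power.\<close>
  have t4: "\<rho> ^ l \<le> real B powr (k2 / c * log 2 \<rho>)"
  proof -
    have "k2 * lb / c \<le> lam / c" using lam c by (intro divide_right_mono) auto
    also have "\<dots> \<le> real l" using l(1) by (simp add: lam_def)
    finally have "log 2 \<rho> * real l \<le> log 2 \<rho> * (k2 * lb / c)"
      using \<rho> by (intro mult_left_mono_neg) auto
    also have "\<dots> = lb * (k2 / c * log 2 \<rho>)" by simp
    finally have "2 powr (log 2 \<rho> * real l) \<le> 2 powr (lb * (k2 / c * log 2 \<rho>))" by simp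
    then have "(2 powr (log 2 \<rho>)) powr real l \<le> (2 powr lb) powr (k2 / c * log 2 \<rho>)"
      unfolding powr_powr .
    then show ?thesis using \<rho> B by (simp add: lb_def powr_realpow)
  qed
  have t34: "real A * 2 powr (real l * c') + real B * \<rho> ^ l
      \<le> real B * (2 powr c' * real B powr (- (k2 * (1 - c' / c))))
        + real B * real B powr (k2 / c * log 2 \<rho>)"
    by (intro add_mono t3 mult_left_mono t4) simp
  have t5: "(real l * m) * (real A * 2 powr (real l * c') + real B * \<rho> ^ l)
      \<le> (2 * real L) * (real B * (2 powr c' * real B powr (- (k2 * (1 - c' / c))))
      + real B * real B powr (k2 / c * log 2 \<rho>))"
    by (rule mult_mono[OF lm2 t34]) (use \<rho> in auto)
  have "real l * (real A * m * 2 powr (real l * c') + real B * m * \<rho> ^ l)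
      = (real l * m) * (real A * 2 powr (real l * c') + real B * \<rho> ^ l)"
    by (simp add: algebra_simps)
  also note t5
  finally show ?thesis
    using t1 t2
    unfolding cost_rate_def LL_def[symmetric] G_def lb_def[symmetric]
    by (simp add: algebra_simps)
qed

theorem theorem8:
  fixes A L :: "nat \<Rightarrow> nat" and \<delta> \<gamma> k1 k2 :: real
  assumes "0 < \<delta>" and "\<delta> < 1 / 2"
    and "\<delta> < \<gamma>" and "\<gamma> < 1 / 2"
    and "0 < k1" and "0 < k2" and "k2 < 1"
    and "filterlim A at_top at_top" and "filterlim L at_top at_top"
    and "\<forall>\<^sub>F B in at_top. real (A B) \<le> real B powr (1 - k2)"
    and "(\<lambda>B. real (L B)) \<in> \<Theta>(\<lambda>B. real B powr k1)"
  shows "\<exists>\<epsilon> :: nat \<Rightarrow> real. \<epsilon> \<in> o(\<lambda>_. 1) \<and>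
    (\<forall>\<^sub>F B in at_top.
      let ratio = measure_pmf.expectation (source_pmf (A B) B (L B) \<delta>)
                    (\<lambda>s. real (afld_length (A B) B (L B) \<delta> \<gamma> s))
                  / pmf_entropy (source_pmf (A B) B (L B) \<delta>)
      in 1 \<le> ratio \<and>
         ratio \<le> (1 + k1) / k2 * (cross_entropy \<gamma> \<delta> / bin_entropy \<delta>) * (1 + \<epsilon> B))"
proof -
  \<comment> \<open>Any value strictly between \<delta> and \<gamma> would do: above \<delta> for
    the Chernoff bound, below \<gamma> for \<open>c' < c\<close>.\<close>
  define \<gamma>' where "\<gamma>' = (\<delta> + \<gamma>) / 2"
  define c where "c = cross_entropy \<gamma> \<delta>"
  define c' where "c' = cross_entropy \<gamma>' \<delta>"
  define h where "h = bin_entropy \<delta>"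
  have \<gamma>': "\<delta> < \<gamma>'" "\<gamma>' < \<gamma>" using assms by (simp_all add: \<gamma>'_def)
  have c: "0 < c" "0 < c'" "c' < c"
    unfolding c_def c'_def using assms \<gamma>'
    by (auto intro: cross_entropy_pos cross_entropy_strict_mono)
  have h: "0 < h" unfolding h_def using assms by (intro bin_entropy_pos) auto
  obtain u where u: "1 \<le> u" "(1 - \<delta> + \<delta> * u) / u powr \<gamma>' < 1"
    using chernoff_base_exists[of \<delta> \<gamma>'] assms \<gamma>' by auto
  define \<rho> where "\<rho> = (1 - \<delta> + \<delta> * u) / u powr \<gamma>'"
  have \<rho>: "0 < \<rho>" "\<rho> < 1" using u assms by (auto simp: \<rho>_def intro!: divide_pos_pos add_pos_pos)
  obtain K2 where K2: "0 < K2" "\<forall>\<^sub>F B in at_top. real (L B) \<le> K2 * real B powr k1"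
    using assms(11) unfolding bigtheta_def by (auto elim!: landau_o.bigE)
  obtain K1 where K1: "0 < K1" "\<forall>\<^sub>F B in at_top. K1 * real B powr k1 \<le> real (L B)"
    using assms(11) unfolding bigtheta_def by (auto elim!: landau_omega.bigE)
  let ?rate = "cost_rate K1 K2 k1 k2 c c' \<rho>"
  let ?ratio = "\<lambda>B. measure_pmf.expectation (source_pmf (A B) B (L B) \<delta>)
      (\<lambda>s. real (afld_length (A B) B (L B) \<delta> \<gamma> s)) / pmf_entropy (source_pmf (A B) B (L B) \<delta>)"
  define C where "C = (1 + k1) / k2 * c"
  have C: "0 < C" unfolding C_def using assms c by (intro mult_pos_pos divide_pos_pos) auto
  \<comment> \<open>Chosen so that \<open>C / h * (1 + \<epsilon> B)\<close> is exactly
    \<open>?rate (real B) / h\<close>.\<close>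
  define \<epsilon> where "\<epsilon> B = ?rate (real B) / C - 1" for B :: nat
  have "((\<lambda>B. ?rate (real B)) \<longlongrightarrow> C) at_top"
    unfolding C_def using assms c \<rho> K1 K2
    by (intro filterlim_compose[OF cost_rate_tendsto filterlim_real_sequentially])
  then have "((\<lambda>B. ?rate (real B) / C - 1) \<longlongrightarrow> C / C - 1) at_top"
    using C by (intro tendsto_intros) auto
  then have "(\<epsilon> \<longlongrightarrow> 0) at_top" using C unfolding \<epsilon>_def by simp
  then have "\<epsilon> \<in> o(\<lambda>_. 1)" by (intro smalloI_tendsto) auto
  moreover
  \<comment> \<open>\<open>L\<close> outgrows \<open>log 2 B\<close>, so eventually the ceiling
    attains the minimum with \<open>D = L\<close> in the chunk length; clipping at \<open>L\<close>
    could break the lower bound on \<open>l\<close>.\<close>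
  have clip: "\<forall>\<^sub>F B in at_top. log 2 (real B) / c + 1 \<le> K1 * real B powr k1"
    using c K1(1) assms(5) by real_asymp
  have "\<forall>\<^sub>F B in at_top. 1 \<le> ?ratio B
      \<and> ?ratio B \<le> (1 + k1) / k2 * (cross_entropy \<gamma> \<delta> / bin_entropy \<delta>) * (1 + \<epsilon> B)"
    using clip K1(2) K2(2) assms(10) eventually_gt_at_top[of 1]
      eventually_compose_filterlim[OF eventually_gt_at_top[of 0] assms(8)]
      eventually_compose_filterlim[OF eventually_gt_at_top[of 0] assms(9)]
  proof eventually_elim
    case (elim B)
    define l where "l = afld_chunk_length (A B) B (L B) \<delta> \<gamma>"
    define lam where "lam = log 2 (real B / real (A B))"
    let ?E = "measure_pmf.expectation (source_pmf (A B) B (L B) \<delta>)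
      (\<lambda>s. real (afld_length (A B) B (L B) \<delta> \<gamma> s))"
    let ?H = "pmf_entropy (source_pmf (A B) B (L B) \<delta>)"
    \<comment> \<open>Strictly fewer symbols than blocks make \<open>lam\<close> positive, hence the
      chunk length nonzero.\<close>
    have "real (A B) \<le> real B powr (1 - k2)" using elim by simp
    also have "\<dots> < real B powr 1" using elim assms by (intro powr_less_mono) auto
    finally have AB: "real (A B) < real B" using elim by simp
    then have lam0: "0 < lam" using elim by (simp add: lam_def)
    have "lam \<le> log 2 (real B)" using elim by (simp add: lam_def log_divide)
    then have "lam / c \<le> log 2 (real B) / c" using c by (simp add: divide_right_mono)
    then have "lam / c + 1 \<le> real (L B)" using elim by linarith
    moreover have "0 < lam / c" using lam0 c by simp
    moreover have "l = min (L B) (nat \<lceil>lam / c\<rceil>)"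
      by (simp add: l_def afld_chunk_length_def lam_def c_def)
    ultimately have l: "lam / c \<le> real l" "real l \<le> lam / c + 1" "l \<le> L B" "l > 0"
      using elim by linarith+
    have E: "?E = measure_pmf.expectation (source_pmf (A B) B (L B) \<delta>)
        (\<lambda>s. real (length (mfld_encode (L B) l s)))"
      by (simp add: afld_length_def l_def)
    have H: "real B * real (L B) * h \<le> ?H"
      using pmf_entropy_source_ge[of \<delta> "A B" B "L B"] elim assms by (simp add: h_def)
    have BLh: "0 < real B * real (L B) * h" using elim h by simp
    have "?H \<le> ?E" unfolding E using elim l by (intro pmf_entropy_source_le) auto
    then have "1 \<le> ?ratio B" using H BLh by simp
    have E_le: "?E \<le> real B * real (L B) * ?rate (real B)"
      unfolding E
      using expectation_mfld_encode_le[of \<delta> u "A B" B "L B" l \<gamma>']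
        cost_le_cost_rate[of c c' \<rho> k1 k2 K1 K2 "A B" B "L B" l] assms elim u c \<rho> K1 K2 l
      by (simp add: lam_def c'_def \<rho>_def)
    \<comment> \<open>\<open>frac_le\<close> needs a nonnegative numerator; this one dominates an
      expected length.\<close>
    then have "0 \<le> real B * real (L B) * ?rate (real B)" by (rule order_trans[rotated]) simp
    then have "?ratio B \<le> real B * real (L B) * ?rate (real B) / (real B * real (L B) * h)"
      using E_le H BLh by (intro frac_le) auto
    also have "\<dots> = ?rate (real B) / h" using elim by simp
    also have "\<dots> = C / h * (1 + \<epsilon> B)"
      using C by (simp add: \<epsilon>_def)
    finally show ?case using \<open>1 \<le> ?ratio B\<close> by (simp add: C_def c_def h_def)
  qed
  ultimately show ?thesis unfolding Let_def by blast
qed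

end
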